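(* Let $n\ge 1$ and, for every $i\in[n]$, let $G_i$ be a finite $d_i$-regular graph. Let $\mathbf{G}:=G_1\square\cdots\square G_n$, let $d:=d_1+\cdots+d_n$, and let $D:=\max_{i\in[n]}d_i$, where $D\ge 1$. Then, for every nonempty $A\subseteq V(\mathbf{G})$, $$e_{\mathbf{G}}(A,A^c)\ge|A|\cdot\bigl(d-D\cdot\log_{D+1}|A|\bigr).$$
   Context: $[n]$ denotes $\{1,\dots,n\}$. For a graph $G$ and $A\subseteq V(G)$, $A^c=V(G)\setminus A$ and $e_G(A,A^c)$ is the number of edges of $G$ with exactly one endpoint in $A$. The product graph $G_1\square\cdots\square G_n$ has vertex set $V(G_1)\times\cdots\times V(G_n)$, and its edges are all pairs $\{u,v\}$ for which there is an index $j\in[n]$ such that $u_jv_j\in E(G_j)$ and $u_l=v_l$ for all $l\neq j$. Graphs are simple. *)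

theory Defs
  imports Complex_Main "HOL-Library.FuncSet"
begin

record 'a sgraph =
  verts :: "'a set"
  edges :: "'a set set"

definition simple_graph :: "'a sgraph \<Rightarrow> bool" where
  "simple_graph G \<longleftrightarrow> (\<forall>e\<in>edges G. e \<subseteq> verts G \<and> card e = 2)"

definition finite_graph :: "'a sgraph \<Rightarrow> bool" where
  "finite_graph G \<longleftrightarrow> simple_graph G \<and> finite (verts G)"

definition vdegree :: "'a sgraph \<Rightarrow> 'a \<Rightarrow> nat" where
  "vdegree G v = card {e \<in> edges G. v \<in> e}"

definition regular_graph :: "'a sgraph \<Rightarrow> nat \<Rightarrow> bool" where
  "regular_graph G k \<longleftrightarrow> (\<forall>v\<in>verts G. vdegree G v = k)"

text \<open>\<open>cut_size G A\<close> is $e_G(A, A^c)$: the number of edges with exactly one endpoint in \<open>A\<close>.\<close>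

definition cut_size :: "'a sgraph \<Rightarrow> 'a set \<Rightarrow> nat" where
  "cut_size G A = card {e \<in> edges G. \<exists>!v. v \<in> e \<and> v \<in> A}"

text \<open>Tuples indexed by \<open>I\<close> are functions that are \<open>undefined\<close> outside \<open>I\<close>, so that distinct
  functions in the vertex set are distinct tuples. All factors share one vertex type, but their
  vertex sets are arbitrary and may differ.\<close>

definition box_product :: "'i set \<Rightarrow> ('i \<Rightarrow> 'a sgraph) \<Rightarrow> ('i \<Rightarrow> 'a) sgraph" where
  "box_product I G = \<lparr>
     verts = (\<Pi>\<^sub>E i\<in>I. verts (G i)),
     edges = {{u, v} | u v.
        u \<in> (\<Pi>\<^sub>E i\<in>I. verts (G i)) \<and> v \<in> (\<Pi>\<^sub>E i\<in>I. verts (G i)) \<and>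
        (\<exists>j\<in>I. {u j, v j} \<in> edges (G j) \<and> (\<forall>l\<in>I. l \<noteq> j \<longrightarrow> u l = v l))} \<rparr>"

lemma finite_graph_box_product:
  assumes "finite I" and "\<And>i. i \<in> I \<Longrightarrow> finite_graph (G i)"
  shows "finite_graph (box_product I G)"
proof -
  have "card {u, v} = 2" if "j \<in> I" "{u j, v j} \<in> edges (G j)" for u v j
  proof -
    have "card {u j, v j} = 2"
      using assms(2)[OF that(1)] that(2) by (auto simp: finite_graph_def simple_graph_def)
    then have "u \<noteq> v" by auto
    then show ?thesis by simp
  qed
  moreover have "finite (\<Pi>\<^sub>E i\<in>I. verts (G i))"
    using assms by (auto intro!: finite_PiE simp: finite_graph_def)
  ultimately show ?thesis
    unfolding finite_graph_def simple_graph_def box_product_def by auto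
qed

end

theory Submission
  imports Defs "HOL-Analysis.Convex"
begin

text \<open>
  Count the ordered adjacent pairs inside \<open>A\<close> by the coordinate in which they differ, and show by
  induction on the set of coordinates that there are at most \<open>D |A| log\<^bsub>D+1\<^esub> |A|\<close> of them; since the
  product is \<open>d\<close>-regular, the other ordered pairs starting in \<open>A\<close> are cut edges. In the induction step,
  slice \<open>A\<close> along a coordinate into parts of sizes \<open>a x\<close>. At most \<open>min (a x) (a y)\<close> pairs join the
  slices \<open>x\<close> and \<open>y\<close>, so what is needed is a bound of the sum of these minima over adjacent \<open>x\<close>, \<open>y\<close>
  by the entropy of \<open>a\<close>. The minima add up over the level sets of \<open>a\<close> while the entropy is
  superadditive (log-sum inequality), which reduces the bound to indicator functions, that is, to
  \<open>min D (s - 1) \<le> D log\<^bsub>D+1\<^esub> s\<close>.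
\<close>

section \<open>Log-sum inequality and superadditivity of entropy\<close>

text \<open>The right side is convex in \<open>u\<close>, and the left side is its tangent at
  \<open>u = U * q\<close>. For \<open>u > 0\<close> this is \<open>ln t \<le> t - 1\<close> at
  \<open>t = U * q / u\<close>.\<close>

lemma mult_ln_tangent:
  fixes u U q :: real
  assumes "u \<ge> 0" "U > 0" "q > 0"
  shows "u * ln q + u - U * q \<le> u * ln u - u * ln U"
proof (cases "u = 0")
  case False
  with assms have "u > 0" by simp
  have "ln (U * q / u) \<le> U * q / u - 1"
    using \<open>u > 0\<close> assms by (intro ln_le_minus_one) simp
  then have "u * ln (U * q / u) \<le> u * (U * q / u - 1)"
    using \<open>u > 0\<close> by (intro mult_left_mono) simp_all
  then show ?thesis
    using \<open>u > 0\<close> assms by (simp add: ln_div ln_mult algebra_simps)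
qed (use assms in simp)

text \<open>Log-sum inequality for two terms. With \<open>q\<close> the ratio of the totals, the
  tangents at \<open>U * q\<close> and \<open>W * q\<close> have the same slope, and their linear
  corrections cancel because \<open>U * q + W * q = u + v\<close>.\<close>

lemma log_sum_pointwise:
  fixes u v U W :: real
  assumes "u \<ge> 0" "v \<ge> 0" "U > 0" "W > 0"
  shows "(u + v) * ln (u + v) - (u + v) * ln (U + W)
           \<le> (u * ln u - u * ln U) + (v * ln v - v * ln W)"
proof (cases "u + v = 0")
  case True
  with assms have "u = 0" "v = 0" by auto
  then show ?thesis by simp
next
  case False
  with assms have pos: "u + v > 0" "U + W > 0" by auto
  define q where "q = (u + v) / (U + W)"
  have "q > 0" using pos by (simp add: q_def)
  have "U * q + W * q = u + v"
    using pos unfolding distrib_right[symmetric] by (simp add: q_def)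
  moreover have "(u + v) * ln q = (u + v) * ln (u + v) - (u + v) * ln (U + W)"
    using pos by (simp add: q_def ln_div algebra_simps)
  ultimately show ?thesis
    using mult_ln_tangent[of u U q] mult_ln_tangent[of v W q] assms \<open>q > 0\<close>
    by (simp add: distrib_right)
qed

text \<open>For nonnegative \<open>a\<close> with total \<open>s > 0\<close> this is
  \<open>s\<close> times the Shannon entropy, in nats, of the distribution \<open>a / s\<close>.
  Zero values of \<open>a\<close> contribute nothing, by the usual convention
  \<open>0 * ln 0 = 0\<close>.\<close>

definition entropy_defect :: "'a set \<Rightarrow> ('a \<Rightarrow> real) \<Rightarrow> real" where
  "entropy_defect V a = sum a V * ln (sum a V) - (\<Sum>x\<in>V. a x * ln (a x))"

text \<open>Concavity of entropy in unnormalised form: the log-sum inequality at each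
  \<open>x\<close>, with the two totals as \<open>U\<close> and \<open>W\<close>, summed over
  \<open>V\<close>. A zero total is treated apart, since \<open>U\<close> and \<open>W\<close> must
  be positive; the function then vanishes on \<open>V\<close>.\<close>

lemma entropy_defect_superadditive:
  assumes "finite V" "\<And>x. x \<in> V \<Longrightarrow> a x \<ge> 0" "\<And>x. x \<in> V \<Longrightarrow> b x \<ge> 0"
  shows "entropy_defect V a + entropy_defect V b \<le> entropy_defect V (\<lambda>x. a x + b x)"
proof -
  consider "sum a V = 0" | "sum b V = 0" | "sum a V > 0" "sum b V > 0"
    using assms by (metis less_eq_real_def sum_nonneg)
  then show ?thesis
  proof cases
    case 1
    then have "\<forall>x\<in>V. a x = 0" using assms by (simp add: sum_nonneg_eq_0_iff)
    then show ?thesis by (simp add: entropy_defect_def sum.distrib)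
  next
    case 2
    then have "\<forall>x\<in>V. b x = 0" using assms by (simp add: sum_nonneg_eq_0_iff)
    then show ?thesis by (simp add: entropy_defect_def sum.distrib)
  next
    case 3
    have expand: "entropy_defect V c = - (\<Sum>x\<in>V. c x * ln (c x) - c x * ln (sum c V))" for c
      by (simp add: entropy_defect_def sum_subtractf sum_distrib_right)
    have "(\<Sum>x\<in>V. (a x + b x) * ln (a x + b x) - (a x + b x) * ln (sum a V + sum b V))
        \<le> (\<Sum>x\<in>V. (a x * ln (a x) - a x * ln (sum a V)) + (b x * ln (b x) - b x * ln (sum b V)))"
      using assms 3 by (intro sum_mono log_sum_pointwise) auto
    then show ?thesis
      by (simp only: expand sum.distrib)
  qed
qed

lemma entropy_defect_indicator:
  assumes "finite V" "S \<subseteq> V"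
  shows "entropy_defect V (\<lambda>x. of_bool (x \<in> S)) = real (card S) * ln (real (card S))"
proof -
  have "(\<Sum>x\<in>V. of_bool (x \<in> S) * ln (of_bool (x \<in> S) :: real)) = 0"
    by (intro sum.neutral) auto
  moreover have "V \<inter> {x. x \<in> S} = S" using assms by auto
  ultimately show ?thesis
    using assms by (simp add: entropy_defect_def sum_of_bool_eq)
qed

section \<open>Sums of minima bounded by entropy\<close>

text \<open>Up to \<open>s = D + 1\<close>, the concave function \<open>ln\<close> lies above its
  chord from \<open>1\<close> to \<open>D + 1\<close>; beyond that the left side is constant.
  Equality at \<open>s = 1\<close> and \<open>s = D + 1\<close> explains the base
  \<open>D + 1\<close> of the logarithm.\<close>

lemma min_pred_ln_le:
  fixes s D :: nat
  assumes "s \<ge> 1" "D \<ge> 1"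
  shows "real (min D (s - 1)) * ln (real D + 1) \<le> real D * ln (real s)"
proof (cases "s \<le> D + 1")
  case True
  define t where "t = (real s - 1) / real D"
  have t: "0 \<le> t" "t \<le> 1" using assms True by (auto simp: t_def field_simps)
  have "(1 - t) * ln 1 + t * ln (real D + 1) \<le> ln ((1 - t) *\<^sub>R 1 + t *\<^sub>R (real D + 1))"
    using t by (intro concave_onD[OF ln_concave]) auto
  also have "(1 - t) *\<^sub>R 1 + t *\<^sub>R (real D + 1) = real s"
    using assms by (simp add: t_def field_simps)
  finally have "real D * (t * ln (real D + 1)) \<le> real D * ln (real s)"
    by (intro mult_left_mono) auto
  moreover have "real D * t = real (min D (s - 1))"
    using assms True by (simp add: t_def of_nat_diff)
  ultimately show ?thesis by (simp flip: mult.assoc)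
next
  case False
  then have "ln (real D + 1) \<le> ln (real s)" by simp
  then show ?thesis using False by (simp add: min_def mult_left_mono)
qed

text \<open>Layer-cake argument: \<open>min (a x) (a y)\<close> counts the level sets of
  \<open>a\<close> that contain both \<open>x\<close> and \<open>y\<close>. Each level set satisfies
  the bound by \<open>min_pred_ln_le\<close>, and superadditivity lets the bounds be added. The
  induction on an upper bound \<open>K\<close> of \<open>a\<close> strips off one layer at a
  time.\<close>

lemma sum_min_le_entropy_defect:
  fixes a :: "'a \<Rightarrow> nat" and D :: nat
  assumes "finite V" "D \<ge> 1"
    and irrefl: "\<And>x. \<not> R x x"
    and deg: "\<And>x. x \<in> V \<Longrightarrow> card {y\<in>V. R x y} \<le> D"
  shows "real (\<Sum>x\<in>V. \<Sum>y\<in>{y\<in>V. R x y}. min (a x) (a y)) * ln (real D + 1)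
           \<le> real D * entropy_defect V (\<lambda>x. real (a x))"
proof -
  have "real (\<Sum>x\<in>V. \<Sum>y\<in>{y\<in>V. R x y}. min (a x) (a y)) * ln (real D + 1)
           \<le> real D * entropy_defect V (\<lambda>x. real (a x))"
    if "\<forall>x\<in>V. a x \<le> K" for K
    using that
  proof (induction K arbitrary: a)
    case 0
    then show ?case by (simp add: entropy_defect_def)
  next
    case (Suc K)
    \<comment> \<open>The bottom layer is the support \<open>S\<close>; \<open>b\<close> is what
      remains above it. Truncated subtraction keeps \<open>b\<close> at 0 outside the
      support.\<close>
    define S where "S = {x\<in>V. a x > 0}"
    define b where "b x = a x - 1" for x
    have S: "S \<subseteq> V" "finite S" using assms(1) by (auto simp: S_def)
    have ab: "real (a x) = real (b x) + of_bool (x \<in> S)" if "x \<in> V" for x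
      using that by (auto simp: S_def b_def)
    have min_ab: "min (a x) (a y) = min (b x) (b y) + of_bool (x \<in> S \<and> y \<in> S)"
      if "x \<in> V" "y \<in> V" for x y
      using that by (auto simp: S_def b_def)
    have "(\<Sum>x\<in>V. \<Sum>y\<in>{y\<in>V. R x y}. of_bool (x \<in> S \<and> y \<in> S)) = (\<Sum>x\<in>S. card {y\<in>S. R x y})"
    proof -
      have "(\<Sum>y\<in>{y\<in>V. R x y}. of_bool (x \<in> S \<and> y \<in> S)) = (if x \<in> S then card {y\<in>S. R x y} else 0)"
        for x
      proof (cases "x \<in> S")
        case True
        have "{y\<in>V. R x y} \<inter> S = {y\<in>S. R x y}" using S by auto
        then show ?thesis using True assms(1) by (simp add: sum_of_bool_eq)
      qed simp
      moreover have "V \<inter> S = S" using S by auto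
      ultimately show ?thesis
        using assms(1) S by (simp add: sum.If_cases)
    qed
    also have "\<dots> \<le> card S * min D (card S - 1)"
    proof -
      \<comment> \<open>The bound \<open>D\<close> comes from the degree, the bound
        \<open>card S - 1\<close> from \<open>x\<close> not being its own neighbour.\<close>
      have "card {y\<in>S. R x y} \<le> min D (card S - 1)" if "x \<in> S" for x
      proof -
        have "card {y\<in>S. R x y} \<le> card {y\<in>V. R x y}"
          using S assms(1) by (intro card_mono) auto
        moreover have "card {y\<in>S. R x y} \<le> card (S - {x})"
          using S irrefl by (intro card_mono) auto
        ultimately show ?thesis
          using deg[of x] that S by auto
      qed
      then show ?thesis
        using sum_bounded_above[of S "\<lambda>x. card {y\<in>S. R x y}" "min D (card S - 1)"] by simp
    qed
    finally have ind: "(\<Sum>x\<in>V. \<Sum>y\<in>{y\<in>V. R x y}. of_bool (x \<in> S \<and> y \<in> S)) \<le> card S * min D (card S - 1)" .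
    have "real (card S * min D (card S - 1)) * ln (real D + 1)
          \<le> real D * (real (card S) * ln (real (card S)))"
    proof (cases "card S = 0")
      case False
      then show ?thesis
        using mult_left_mono[OF min_pred_ln_le[of "card S" D], of "real (card S)"] assms(2)
        by (simp add: mult_ac)
    qed simp
    then have "real (\<Sum>x\<in>V. \<Sum>y\<in>{y\<in>V. R x y}. of_bool (x \<in> S \<and> y \<in> S)) * ln (real D + 1)
        \<le> real D * entropy_defect V (\<lambda>x. of_bool (x \<in> S))"
      using mult_right_mono[OF of_nat_mono[OF ind], of "ln (real D + 1)"]
      unfolding entropy_defect_indicator[OF assms(1) S(1)] by (auto intro: order_trans)
    moreover have "real (\<Sum>x\<in>V. \<Sum>y\<in>{y\<in>V. R x y}. min (b x) (b y)) * ln (real D + 1)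
        \<le> real D * entropy_defect V (\<lambda>x. real (b x))"
      using Suc.prems by (intro Suc.IH) (auto simp: b_def)
    moreover have "(\<Sum>x\<in>V. \<Sum>y\<in>{y\<in>V. R x y}. min (a x) (a y))
      = (\<Sum>x\<in>V. \<Sum>y\<in>{y\<in>V. R x y}. min (b x) (b y)) + (\<Sum>x\<in>V. \<Sum>y\<in>{y\<in>V. R x y}. of_bool (x \<in> S \<and> y \<in> S))"
      unfolding sum.distrib[symmetric] by (intro sum.cong refl) (simp add: min_ab)
    moreover have "real D * (entropy_defect V (\<lambda>x. real (b x)) + entropy_defect V (\<lambda>x. of_bool (x \<in> S)))
      \<le> real D * entropy_defect V (\<lambda>x. real (b x) + of_bool (x \<in> S))"
      by (intro mult_left_mono entropy_defect_superadditive assms) auto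
    moreover have "entropy_defect V (\<lambda>x. real (b x) + of_bool (x \<in> S)) = entropy_defect V (\<lambda>x. real (a x))"
      by (simp add: entropy_defect_def ab cong: sum.cong)
    ultimately show ?case
      by (simp only: of_nat_add distrib_right distrib_left)
  qed
  from this[of "\<Sum>x\<in>V. a x"] show ?thesis
    using assms(1) by (simp add: member_le_sum)
qed

section \<open>Adjacent pairs inside a set of tuples\<close>

text \<open>For irreflexive \<open>R j\<close>, this is the number of neighbours of \<open>u\<close>
  in \<open>A\<close> along direction \<open>j\<close>. No ambient vertex set occurs, so
  \<open>A\<close> can be replaced by its slices.\<close>

definition inner_degree :: "('i \<Rightarrow> 'a \<Rightarrow> 'a \<Rightarrow> bool) \<Rightarrow> ('i \<Rightarrow> 'a) set \<Rightarrow> 'i \<Rightarrow> ('i \<Rightarrow> 'a) \<Rightarrow> nat" where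
  "inner_degree R A j u = card {y. R j (u j) y \<and> u(j := y) \<in> A}"

text \<open>Overwriting coordinate \<open>i\<close> by \<open>y\<close> is a partial injection from
  slice \<open>x\<close> into slice \<open>y\<close>, so the number of pairs between the two slices
  is at most the size of either.\<close>

lemma sum_inner_degree_direction_le:
  fixes i :: 'i and A :: "('i \<Rightarrow> 'a) set"
  assumes "finite A"
  defines "V \<equiv> (\<lambda>u. u i) ` A"
  defines "slice \<equiv> \<lambda>x. {u\<in>A. u i = x}"
  shows "(\<Sum>u\<in>A. inner_degree R A i u)
    \<le> (\<Sum>x\<in>V. \<Sum>y\<in>{y\<in>V. R i x y}. min (card (slice x)) (card (slice y)))"
proof -
  have fin: "finite V" "finite (slice x)" for x
    using assms by (auto simp: V_def slice_def)
  have "(\<Sum>u\<in>A. inner_degree R A i u) = (\<Sum>x\<in>V. \<Sum>u\<in>slice x. inner_degree R A i u)"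
    unfolding V_def slice_def using assms(1) by (intro sum.image_gen) auto
  also have "\<dots> = (\<Sum>x\<in>V. \<Sum>u\<in>slice x. \<Sum>y\<in>{y\<in>V. R i x y}. of_bool (u(i := y) \<in> A))"
  proof (intro sum.cong refl)
    fix x u assume u: "u \<in> slice x"
    have "y \<in> V" if "u(i := y) \<in> A" for y
      unfolding V_def using that by (rule rev_image_eqI) simp
    with u have "{y. R i (u i) y \<and> u(i := y) \<in> A} = {y\<in>V. R i x y} \<inter> {y. u(i := y) \<in> A}"
      by (auto simp: slice_def)
    then show "inner_degree R A i u = (\<Sum>y\<in>{y\<in>V. R i x y}. of_bool (u(i := y) \<in> A))"
      using fin by (simp add: inner_degree_def sum_of_bool_eq)
  qed
  also have "\<dots> = (\<Sum>x\<in>V. \<Sum>y\<in>{y\<in>V. R i x y}. card {u\<in>slice x. u(i := y) \<in> A})"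
    using fin by (subst sum.swap) (simp add: sum_of_bool_eq Int_def)
  also have "\<dots> \<le> (\<Sum>x\<in>V. \<Sum>y\<in>{y\<in>V. R i x y}. min (card (slice x)) (card (slice y)))"
  proof (intro sum_mono min.boundedI)
    fix x y
    show "card {u\<in>slice x. u(i := y) \<in> A} \<le> card (slice x)"
      using fin by (intro card_mono) auto
    have "inj_on (\<lambda>u. u(i := y)) {u\<in>slice x. u(i := y) \<in> A}"
    proof (rule inj_onI)
      fix u v assume "u \<in> {u\<in>slice x. u(i := y) \<in> A}" "v \<in> {u\<in>slice x. u(i := y) \<in> A}"
        and eq: "u(i := y) = v(i := y)"
      then have "u i = v i" by (simp add: slice_def)
      with eq show "u = v" by (metis fun_upd_triv fun_upd_upd)
    qed
    then show "card {u\<in>slice x. u(i := y) \<in> A} \<le> card (slice y)"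
      using fin(2)[of y] by (intro card_inj_on_le[where f = "\<lambda>u. u(i := y)"]) (auto simp: slice_def)
  qed
  finally show ?thesis .
qed

text \<open>Slice \<open>A\<close> along the new coordinate \<open>i\<close>. Pairs in the other
  directions stay within a slice, and the induction hypothesis bounds them by the sum of
  \<open>a x * ln (a x)\<close>. Direction \<open>i\<close> is bounded by the entropy of the slice
  sizes, in which exactly this sum is subtracted, so only the term for \<open>card A\<close>
  survives.\<close>

lemma sum_inner_degree_le:
  assumes "finite I" "finite A" "D \<ge> 1"
    and irrefl: "\<And>j x. j \<in> I \<Longrightarrow> \<not> R j x x"
    and deg: "\<And>j u. j \<in> I \<Longrightarrow> u \<in> A \<Longrightarrow> finite {y. R j (u j) y} \<and> card {y. R j (u j) y} \<le> D"
  shows "real (\<Sum>j\<in>I. \<Sum>u\<in>A. inner_degree R A j u) * ln (real D + 1)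
           \<le> real D * (real (card A) * ln (real (card A)))"
  using assms(1,2) irrefl deg
proof (induction I arbitrary: A rule: finite_induct)
  case empty
  then show ?case
    by (cases "card A") simp_all
next
  case (insert i I)
  define V where "V = (\<lambda>u. u i) ` A"
  define slice where "slice x = {u\<in>A. u i = x}" for x
  define a where "a x = card (slice x)" for x
  have "finite V" using insert.prems by (simp add: V_def)
  have card_A: "card A = (\<Sum>x\<in>V. a x)"
    using sum.image_gen[of A "\<lambda>_. 1::nat" "\<lambda>u. u i"] insert.prems
    by (simp add: a_def slice_def V_def)
  have "(\<Sum>j\<in>I. \<Sum>u\<in>A. inner_degree R A j u)
      = (\<Sum>j\<in>I. \<Sum>x\<in>V. \<Sum>u\<in>slice x. inner_degree R A j u)"
    unfolding V_def slice_def using insert.prems by (intro sum.cong refl sum.image_gen) auto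
  also have "\<dots> = (\<Sum>j\<in>I. \<Sum>x\<in>V. \<Sum>u\<in>slice x. inner_degree R (slice x) j u)"
  proof (intro sum.cong refl)
    fix j x u assume "j \<in> I" "u \<in> slice x"
    \<comment> \<open>A change in coordinate \<open>j\<close> leaves coordinate \<open>i\<close>
      alone, hence does not leave the slice.\<close>
    then have "j \<noteq> i" using insert.hyps by auto
    then show "inner_degree R A j u = inner_degree R (slice x) j u"
      using \<open>u \<in> slice x\<close> by (simp add: inner_degree_def slice_def)
  qed
  also have "\<dots> = (\<Sum>x\<in>V. \<Sum>j\<in>I. \<Sum>u\<in>slice x. inner_degree R (slice x) j u)"
    by (rule sum.swap)
  finally have "real (\<Sum>j\<in>I. \<Sum>u\<in>A. inner_degree R A j u) * ln (real D + 1)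
      = (\<Sum>x\<in>V. real (\<Sum>j\<in>I. \<Sum>u\<in>slice x. inner_degree R (slice x) j u) * ln (real D + 1))"
    by (simp only: of_nat_sum sum_distrib_right)
  also have "\<dots> \<le> (\<Sum>x\<in>V. real D * (real (a x) * ln (real (a x))))"
    unfolding a_def
    by (intro sum_mono insert.IH) (use insert.prems in \<open>auto simp: slice_def\<close>)
  finally have rest: "real (\<Sum>j\<in>I. \<Sum>u\<in>A. inner_degree R A j u) * ln (real D + 1)
      \<le> real D * (\<Sum>x\<in>V. real (a x) * ln (real (a x)))"
    by (simp add: sum_distrib_left)
  have "card {y\<in>V. R i x y} \<le> D" if x: "x \<in> V" for x
  proof -
    obtain u where "u \<in> A" "u i = x" using x by (auto simp: V_def)
    then have *: "finite {y. R i x y}" "card {y. R i x y} \<le> D"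
      using insert.prems(3)[of i u] by auto
    have "card {y\<in>V. R i x y} \<le> card {y. R i x y}"
      using * by (intro card_mono) auto
    with * show ?thesis by simp
  qed
  then have "real (\<Sum>x\<in>V. \<Sum>y\<in>{y\<in>V. R i x y}. min (a x) (a y)) * ln (real D + 1)
      \<le> real D * entropy_defect V (\<lambda>x. real (a x))"
    using insert.prems \<open>finite V\<close> assms(3) by (intro sum_min_le_entropy_defect) auto
  moreover have "(\<Sum>u\<in>A. inner_degree R A i u) \<le> (\<Sum>x\<in>V. \<Sum>y\<in>{y\<in>V. R i x y}. min (a x) (a y))"
    unfolding a_def slice_def V_def
    using insert.prems by (intro sum_inner_degree_direction_le) auto
  then have "real (\<Sum>u\<in>A. inner_degree R A i u) * ln (real D + 1)
      \<le> real (\<Sum>x\<in>V. \<Sum>y\<in>{y\<in>V. R i x y}. min (a x) (a y)) * ln (real D + 1)"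
    by (intro mult_right_mono) (auto simp only: of_nat_le_iff, simp)
  moreover have "entropy_defect V (\<lambda>x. real (a x))
      = real (card A) * ln (real (card A)) - (\<Sum>x\<in>V. real (a x) * ln (real (a x)))"
    by (simp add: entropy_defect_def card_A)
  ultimately have "real (\<Sum>u\<in>A. inner_degree R A i u) * ln (real D + 1)
      \<le> real D * (real (card A) * ln (real (card A))) - real D * (\<Sum>x\<in>V. real (a x) * ln (real (a x)))"
    by (simp only: right_diff_distrib)
  moreover have "real (\<Sum>j\<in>insert i I. \<Sum>u\<in>A. inner_degree R A j u) * ln (real D + 1)
      = real (\<Sum>u\<in>A. inner_degree R A i u) * ln (real D + 1)
        + real (\<Sum>j\<in>I. \<Sum>u\<in>A. inner_degree R A j u) * ln (real D + 1)"
    using insert.hyps by (simp add: distrib_right)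
  ultimately show ?case using rest by linarith
qed

section \<open>Degrees and cut edges in the product\<close>

text \<open>Edges have two elements, so \<open>y \<mapsto> {x, y}\<close> is a bijection from the
  neighbours of \<open>x\<close> to the edges at \<open>x\<close>.\<close>

lemma simple_graph_neighbours:
  assumes "finite_graph G"
  shows "finite {y. {x, y} \<in> edges G}" "card {y. {x, y} \<in> edges G} = vdegree G x"
proof -
  have sg: "\<And>e. e \<in> edges G \<Longrightarrow> e \<subseteq> verts G \<and> card e = 2" and fin: "finite (verts G)"
    using assms by (auto simp: finite_graph_def simple_graph_def)
  show "finite {y. {x, y} \<in> edges G}"
    by (rule finite_subset[OF _ fin]) (use sg in auto)
  have "{e\<in>edges G. x \<in> e} = (\<lambda>y. {x, y}) ` {y. {x, y} \<in> edges G}"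
  proof (intro equalityI subsetI)
    fix e assume e: "e \<in> {e\<in>edges G. x \<in> e}"
    then obtain y where "e = {x, y}"
      using sg[of e] by (auto simp: card_2_iff)
    with e show "e \<in> (\<lambda>y. {x, y}) ` {y. {x, y} \<in> edges G}" by auto
  qed auto
  moreover have "inj_on (\<lambda>y. {x, y}) {y. {x, y} \<in> edges G}"
    by (auto simp: inj_on_def doubleton_eq_iff)
  ultimately show "card {y. {x, y} \<in> edges G} = vdegree G x"
    by (simp add: vdegree_def card_image)
qed

text \<open>A triple \<open>(j, u, y)\<close> counted on the left yields the cut edge
  \<open>{u, u(j := y)}\<close>, and this assignment is injective.\<close>

lemma cut_size_box_product_ge:
  assumes "finite I" and fg: "\<And>i. i \<in> I \<Longrightarrow> finite_graph (G i)"
    and A: "A \<subseteq> verts (box_product I G)"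
  shows "(\<Sum>j\<in>I. \<Sum>u\<in>A. card {y. {u j, y} \<in> edges (G j) \<and> u(j := y) \<notin> A})
           \<le> cut_size (box_product I G) A"
proof -
  define B where "B u j = {y. {u j, y} \<in> edges (G j) \<and> u(j := y) \<notin> A}" for u j
  define T where "T = (SIGMA j:I. SIGMA u:A. B u j)"
  define f where "f = (\<lambda>(j, u, y). {u, u(j := y) :: 'a \<Rightarrow> 'b})"
  have fgp: "finite_graph (box_product I G)"
    using assms by (intro finite_graph_box_product)
  then have "finite A"
    using A finite_subset by (auto simp: finite_graph_def)
  have "finite (B u j)" if "j \<in> I" for u j
    using simple_graph_neighbours(1)[OF fg[OF that], of "u j"]
    by (rule finite_subset[rotated]) (auto simp: B_def)
  then have "(\<Sum>j\<in>I. \<Sum>u\<in>A. card (B u j)) = card T"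
    using \<open>finite I\<close> \<open>finite A\<close> by (simp add: T_def)
  also have "\<dots> \<le> card {e\<in>edges (box_product I G). \<exists>!v. v \<in> e \<and> v \<in> A}"
  proof (rule card_inj_on_le)
    show "finite {e\<in>edges (box_product I G). \<exists>!v. v \<in> e \<and> v \<in> A}"
      by (rule finite_subset[of _ "Pow (verts (box_product I G))"])
        (use fgp in \<open>auto simp: finite_graph_def simple_graph_def\<close>)
    show "f ` T \<subseteq> {e\<in>edges (box_product I G). \<exists>!v. v \<in> e \<and> v \<in> A}"
    proof
      fix e assume "e \<in> f ` T"
      then obtain j u y where j: "j \<in> I" and u: "u \<in> A" and uy: "{u j, y} \<in> edges (G j)"
        and nA: "u(j := y) \<notin> A" and e: "e = {u, u(j := y)}"
        by (auto simp: T_def B_def f_def)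
      have uV: "u \<in> (\<Pi>\<^sub>E i\<in>I. verts (G i))" using u A by (auto simp: box_product_def)
      have "y \<in> verts (G j)"
        using fg[OF j] uy by (auto simp: finite_graph_def simple_graph_def)
      then have "u(j := y) \<in> (\<Pi>\<^sub>E i\<in>I. verts (G i))"
        using uV j by (auto simp: PiE_iff extensional_def)
      moreover have "\<exists>k\<in>I. {u k, (u(j := y)) k} \<in> edges (G k) \<and> (\<forall>l\<in>I. l \<noteq> k \<longrightarrow> u l = (u(j := y)) l)"
        using j uy by (intro bexI[of _ j]) auto
      ultimately have "e \<in> edges (box_product I G)"
        using uV unfolding e box_product_def sgraph.simps by blast
      moreover have "\<exists>!v. v \<in> e \<and> v \<in> A" using u nA by (auto simp: e)
      ultimately show "e \<in> {e\<in>edges (box_product I G). \<exists>!v. v \<in> e \<and> v \<in> A}" by blast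
    qed
    show "inj_on f T"
    proof (rule inj_onI)
      fix p q assume pq: "p \<in> T" "q \<in> T" "f p = f q"
      obtain j u y j' u' y' where p: "p = (j, u, y)" and q: "q = (j', u', y')"
        by (metis prod_cases3)
      \<comment> \<open>The endpoint in \<open>A\<close> is \<open>u\<close> and the one outside is
        \<open>u(j := y)\<close>, so the edge determines both.\<close>
      have eqs: "u = u'" "u(j := y) = u'(j' := y')"
        using pq by (auto simp: p q T_def B_def f_def doubleton_eq_iff)
      \<comment> \<open>As there are no loops, the endpoints really differ at \<open>j\<close>,
        which recovers \<open>j\<close> and then \<open>y\<close>.\<close>
      have "card {u j, y} = 2"
        using pq(1) fg by (auto simp: p T_def B_def finite_graph_def simple_graph_def)
      then have "u j \<noteq> y" by auto
      then have "j = j'" using eqs by (metis fun_upd_other fun_upd_same)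
      then show "p = q"
        using eqs by (metis p q fun_upd_same)
    qed
  qed
  finally show ?thesis by (simp add: B_def cut_size_def)
qed

section \<open>The edge-isoperimetric inequality\<close>

theorem mainTheorem3:
  fixes n :: nat
    and G :: "nat \<Rightarrow> 'a sgraph"
    and deg :: "nat \<Rightarrow> nat"
    and d D :: nat
    and A :: "(nat \<Rightarrow> 'a) set"
  assumes "n \<ge> 1"
    and "\<And>i. i \<in> {1..n} \<Longrightarrow> finite_graph (G i)"
    and "\<And>i. i \<in> {1..n} \<Longrightarrow> regular_graph (G i) (deg i)"
    and "d = (\<Sum>i\<in>{1..n}. deg i)"
    and "D = Max (deg ` {1..n})"
    and "D \<ge> 1"
    and "A \<subseteq> verts (box_product {1..n} G)"
    and "A \<noteq> {}"
  shows "real (cut_size (box_product {1..n} G) A)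
           \<ge> real (card A) * (real d - real D * log (real D + 1) (real (card A)))"
proof -
  define R where "R j x y \<longleftrightarrow> {x, y} \<in> edges (G j)" for j x y
  have "finite A"
    using finite_graph_box_product[of "{1..n}" G] assms(2,7) finite_subset
    by (auto simp: finite_graph_def)
  have nbr: "finite {y. R j (u j) y}" "card {y. R j (u j) y} = deg j" if "j \<in> {1..n}" "u \<in> A" for j u
  proof -
    have "u j \<in> verts (G j)" using that assms(7) by (auto simp: box_product_def PiE_iff)
    then show "finite {y. R j (u j) y}" "card {y. R j (u j) y} = deg j"
      using simple_graph_neighbours[of "G j" "u j"] assms(2,3) that
      by (auto simp: R_def regular_graph_def)
  qed
  \<comment> \<open>The \<open>deg j\<close> neighbours of \<open>u\<close> in direction
    \<open>j\<close> lie either inside or outside \<open>A\<close>. Summing over \<open>j\<close>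
    and \<open>u\<close> gives \<open>card A * d\<close> ordered pairs.\<close>
  have split: "inner_degree R A j u + card {y. R j (u j) y \<and> u(j := y) \<notin> A} = deg j"
    if "j \<in> {1..n}" "u \<in> A" for j u
  proof -
    have "{y. R j (u j) y \<and> u(j := y) \<in> A} = {y. R j (u j) y} \<inter> {y. u(j := y) \<in> A}"
      and "{y. R j (u j) y \<and> u(j := y) \<notin> A} = {y. R j (u j) y} - {y. u(j := y) \<in> A}"
      by auto
    then have "inner_degree R A j u + card {y. R j (u j) y \<and> u(j := y) \<notin> A} = card {y. R j (u j) y}"
      using card_Int_Diff[OF nbr(1)[OF that]] by (simp add: inner_degree_def)
    then show ?thesis using nbr(2)[OF that] by simp
  qed
  have "(\<Sum>j\<in>{1..n}. \<Sum>u\<in>A. inner_degree R A j u)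
      + (\<Sum>j\<in>{1..n}. \<Sum>u\<in>A. card {y. R j (u j) y \<and> u(j := y) \<notin> A}) = card A * d"
    unfolding sum.distrib[symmetric] by (simp add: split assms(4) sum_distrib_left)
  moreover have "(\<Sum>j\<in>{1..n}. \<Sum>u\<in>A. card {y. R j (u j) y \<and> u(j := y) \<notin> A})
      \<le> cut_size (box_product {1..n} G) A"
    unfolding R_def using assms by (intro cut_size_box_product_ge) auto
  ultimately have "card A * d \<le> cut_size (box_product {1..n} G) A
      + (\<Sum>j\<in>{1..n}. \<Sum>u\<in>A. inner_degree R A j u)"
    by linarith
  then have "real (card A) * real d \<le> real (cut_size (box_product {1..n} G) A)
      + real (\<Sum>j\<in>{1..n}. \<Sum>u\<in>A. inner_degree R A j u)"
    by (simp only: flip: of_nat_mult of_nat_add of_nat_le_iff)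
  moreover have "real (\<Sum>j\<in>{1..n}. \<Sum>u\<in>A. inner_degree R A j u) * ln (real D + 1)
      \<le> real D * (real (card A) * ln (real (card A)))"
  proof (intro sum_inner_degree_le)
    show "\<not> R j x x" if "j \<in> {1..n}" for j x
    proof
      assume "R j x x"
      then have "card {x, x} = 2"
        using assms(2)[OF that] unfolding R_def finite_graph_def simple_graph_def by blast
      then show False by simp
    qed
    show "finite {y. R j (u j) y} \<and> card {y. R j (u j) y} \<le> D" if "j \<in> {1..n}" "u \<in> A" for j u
      using nbr[OF that] that assms(5) by auto
  qed (use assms(6) \<open>finite A\<close> in auto)
  \<comment> \<open>Division by \<open>ln (D + 1)\<close>, positive since \<open>D \<ge> 1\<close>,
    turns \<open>ln\<close> into the logarithm to base \<open>D + 1\<close>.\<close>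
  then have "real (\<Sum>j\<in>{1..n}. \<Sum>u\<in>A. inner_degree R A j u)
      \<le> real D * real (card A) * log (real D + 1) (real (card A))"
    using assms(6) by (simp add: log_def pos_le_divide_eq mult.assoc)
  ultimately show ?thesis
    by (simp add: algebra_simps)
qed

end
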